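(* For every integer $n\geqslant 3$, $$ D_n(t)=2ntD_{n-1}(t)+2t(1-t)D_{n-1}'(t)+(t^{-1}-t)D_{n-1}^{0,1}(t)+(1-t)^2D_{n-1}^{\geqslant 2}(t)+2(1-t)D_{n-1}^{0,\geqslant 2}(t). $$
   Context: $B_n$ is the group of signed permutations $\pi=\pi_1\pi_2\cdots\pi_n$ of $\{1,\dots,n\}$, and $D_n\subset B_n$ is the subgroup (Coxeter group of type $D$) of those with an even number of negative entries. For $n\geqslant 2$, an index $i\in\{0,1,\dots,n-1\}$ is a ($D$-)descent of $\pi$ if $\pi_i>\pi_{i+1}$, where $\pi_0:=-\pi_2$; $d(\pi)$ is the number of descents. For $n\geqslant 2$, $D_n(t)=\sum_{\pi\in D_n}t^{d(\pi)}$ is the Eulerian polynomial of type $D$, and $D_n^{0,1}(t)$, $D_n^{\geqslant 2}(t)$, $D_n^{0,\geqslant 2}(t)$ (sub-Eulerian polynomials) are the sums of $t^{d(\pi)}$ over those $\pi\in D_n$ such that, respectively: both $0$ and $1$ are descents; neither $0$ nor $1$ is a descent; $0$ is a descent but $1$ is not. *)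

theory Defs
  imports
    "HOL-Combinatorics.Permutations"
    "HOL-Computational_Algebra.Polynomial_Factorial"
begin

text \<open>
  A signed permutation of \<open>{1..n}\<close> is a permutation of \<open>{-n..n}\<close> that commutes with negation.
  It fixes \<open>0\<close>, and its window notation is \<open>\<pi> 1, \<dots>, \<pi> n\<close>.
\<close>

definition signed_perms :: "nat \<Rightarrow> (int \<Rightarrow> int) set" where
  "signed_perms n = {\<pi>. \<pi> permutes {- int n..int n} \<and> (\<forall>i. \<pi> (- i) = - \<pi> i)}"

definition even_signed_perms :: "nat \<Rightarrow> (int \<Rightarrow> int) set" where
  "even_signed_perms n = {\<pi> \<in> signed_perms n. even (card {i \<in> {1..int n}. \<pi> i < 0})}"

lemma finite_even_signed_perms: "finite (even_signed_perms n)"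
proof (rule finite_subset)
  show "even_signed_perms n \<subseteq> {\<pi>. \<pi> permutes {- int n..int n}}"
    by (auto simp: even_signed_perms_def signed_perms_def)
qed (simp add: finite_permutations)

text \<open>
  The convention \<open>\<pi>\<^sub>0 = - \<pi>\<^sub>2\<close> of type \<open>D\<close> concerns the window only; it overrides the
  value \<open>\<pi> 0 = 0\<close> of the underlying function.
\<close>

definition entryD :: "(int \<Rightarrow> int) \<Rightarrow> nat \<Rightarrow> int" where
  "entryD \<pi> i = (if i = 0 then - \<pi> 2 else \<pi> (int i))"

definition desD_set :: "nat \<Rightarrow> (int \<Rightarrow> int) \<Rightarrow> nat set" where
  "desD_set n \<pi> = {i. i < n \<and> entryD \<pi> i > entryD \<pi> (i + 1)}"

definition desD :: "nat \<Rightarrow> (int \<Rightarrow> int) \<Rightarrow> nat" where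
  "desD n \<pi> = card (desD_set n \<pi>)"

text \<open>These polynomials are meaningful for \<open>n \<ge> 2\<close> only.\<close>

definition eulerianD :: "nat \<Rightarrow> int poly" where
  "eulerianD n = (\<Sum>\<pi>\<in>even_signed_perms n. [:0, 1:] ^ desD n \<pi>)"

definition eulerianD_01 :: "nat \<Rightarrow> int poly" where
  "eulerianD_01 n =
     (\<Sum>\<pi> | \<pi> \<in> even_signed_perms n \<and> 0 \<in> desD_set n \<pi> \<and> 1 \<in> desD_set n \<pi>. [:0, 1:] ^ desD n \<pi>)"

definition eulerianD_ge2 :: "nat \<Rightarrow> int poly" where
  "eulerianD_ge2 n =
     (\<Sum>\<pi> | \<pi> \<in> even_signed_perms n \<and> 0 \<notin> desD_set n \<pi> \<and> 1 \<notin> desD_set n \<pi>. [:0, 1:] ^ desD n \<pi>)"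

definition eulerianD_0_ge2 :: "nat \<Rightarrow> int poly" where
  "eulerianD_0_ge2 n =
     (\<Sum>\<pi> | \<pi> \<in> even_signed_perms n \<and> 0 \<in> desD_set n \<pi> \<and> 1 \<notin> desD_set n \<pi>. [:0, 1:] ^ desD n \<pi>)"

text \<open>
  The recurrence involves \<open>t\<^sup>-\<^sup>1\<close>, so it is stated in the field of fractions of \<open>\<int>[t]\<close>,
  into which \<^const>\<open>to_fract\<close> embeds \<open>\<int>[t]\<close>.
\<close>

definition tvar :: "int poly fract" where
  "tvar = to_fract [:0, 1:]"

end

theory Submission
  imports Defs
begin

text \<open>
  The group \<open>D\<^sub>n\<close> is replaced by the larger group \<open>B\<^sub>n\<close>. Changing the sign of the entry of
  absolute value \<open>1\<close> alters the parity of the number of negative entries but no \<open>D\<close>-descent: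
  whether \<open>\<pi>\<^sub>i > \<pi>\<^sub>i\<^sub>+\<^sub>1\<close> or \<open>\<pi>\<^sub>1 + \<pi>\<^sub>2 < 0\<close> holds does not depend on the sign of an entry whose
  absolute value is the smaller of the two. Hence every sum over \<open>B\<^sub>n\<close> of a function of the
  \<open>D\<close>-descent set is twice the same sum over \<open>D\<^sub>n\<close> (\<open>sum_signed_perms_desD_set\<close>).

  In \<open>B\<^sub>n\<close> there is no parity constraint, so each element arises exactly once from some
  \<open>\<sigma> \<in> B\<^sub>n\<^sub>-\<^sub>1\<close> by inserting \<open>n\<close> or \<open>-n\<close> at one of \<open>n\<close> places
  (\<open>signed_perms_Suc_insertion\<close>). Let \<open>\<sigma>\<close> have \<open>d\<close> descents, and let \<open>e\<^sub>i\<close> be \<open>1\<close> or \<open>0\<close>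
  according to whether \<open>i\<close> is a descent of \<open>\<sigma>\<close>. The new letter has the largest absolute
  value, so all comparisons with it are decided by its sign:

  \<^item> at the end of the word, \<open>n\<close> gives \<open>d\<close> descents and \<open>-n\<close> gives \<open>d + 1\<close>;

  \<^item> as second letter it separates the pair \<open>\<sigma>\<^sub>1, \<sigma>\<^sub>2\<close>, which governs both positions \<open>0\<close> and
    \<open>1\<close>, so \<open>e\<^sub>0\<close> and \<open>e\<^sub>1\<close> are lost; \<open>n\<close> gives \<open>d - e\<^sub>0 - e\<^sub>1 + 1\<close> descents and \<open>-n\<close> gives
    \<open>d - e\<^sub>0 - e\<^sub>1 + 2\<close>;

  \<^item> as \<open>k\<close>-th letter at any other place, either sign replaces position \<open>k - 1\<close> by two positions
    with exactly one descent among them, which gives \<open>d - e\<^sub>k\<^sub>-\<^sub>1 + 1\<close> descents.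

  Summing \<open>t\<close> to these powers over the \<open>2n\<close> insertions into \<open>\<sigma>\<close> gives \<open>2nt \<cdot> t\<^sup>d + 2t(1-t) \<cdot> dt\<^sup>d\<^sup>-\<^sup>1\<close>
  plus \<open>t\<^sup>d\<close> times a factor that depends on \<open>e\<^sub>0\<close> and \<open>e\<^sub>1\<close> only; this factor is zero if \<open>1\<close> but not
  \<open>0\<close> is a descent (\<open>sum_over_insertions\<close>). So the recurrence holds term by term over
  \<open>B\<^sub>n\<^sub>-\<^sub>1\<close>, and halving both sides returns to type \<open>D\<close>.
\<close>

section \<open>Signed permutations\<close>

lemma signed_permsD:
  assumes "\<pi> \<in> signed_perms n"
  shows signed_perms_permutes: "\<pi> permutes {- int n..int n}"
    and signed_perms_minus: "\<pi> (- i) = - \<pi> i"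
    and signed_perms_zero: "\<pi> 0 = 0"
proof -
  show "\<pi> permutes {- int n..int n}" and minus: "\<pi> (- i) = - \<pi> i" for i
    using assms by (auto simp: signed_perms_def)
  show "\<pi> 0 = 0"
    using minus[of 0] by simp
qed

lemma signed_perms_abs_eq:
  assumes "\<pi> \<in> signed_perms n" "\<bar>\<pi> i\<bar> = \<bar>\<pi> j\<bar>"
  shows "\<bar>i\<bar> = \<bar>j\<bar>"
proof -
  have "inj \<pi>"
    using signed_perms_permutes[OF assms(1)] by (rule permutes_inj)
  moreover have "\<pi> i = \<pi> j \<or> \<pi> i = \<pi> (- j)"
    using assms(2) signed_perms_minus[OF assms(1)] by (auto simp: abs_eq_iff)
  ultimately have "i = j \<or> i = - j"
    unfolding inj_eq[OF \<open>inj \<pi>\<close>] by simp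
  then show ?thesis
    by auto
qed

lemma signed_perms_abs_le:
  assumes "\<pi> \<in> signed_perms n" "\<bar>i\<bar> \<le> int n"
  shows "\<bar>\<pi> i\<bar> \<le> int n"
proof -
  have "\<pi> i \<in> {- int n..int n}"
    using permutes_in_image[OF signed_perms_permutes[OF assms(1)], of i] assms(2) by auto
  then show ?thesis by auto
qed

lemma finite_signed_perms: "finite (signed_perms n)"
  by (rule finite_subset[OF _ finite_permutations[of "{- int n..int n}"]])
     (auto simp: signed_perms_def)

lemma signed_perms_comp:
  "\<sigma> \<in> signed_perms n \<Longrightarrow> \<tau> \<in> signed_perms n \<Longrightarrow> \<sigma> \<circ> \<tau> \<in> signed_perms n"
  unfolding signed_perms_def by (simp add: permutes_compose)

lemma signed_perms_Suc: "\<sigma> \<in> signed_perms m \<Longrightarrow> \<sigma> \<in> signed_perms (Suc m)"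
  using permutes_subset[of \<sigma> "{- int m..int m}" "{- int (Suc m)..int (Suc m)}"]
  by (simp add: signed_perms_def)

section \<open>From type D to type B\<close>

definition flip_one :: "int \<Rightarrow> int" where
  "flip_one = Transposition.transpose 1 (-1)"

lemma flip_one_eq: "flip_one a = (if \<bar>a\<bar> = 1 then - a else a)"
  by (auto simp: flip_one_def Transposition.transpose_def)

lemma flip_one_signed_perms:
  assumes "n \<ge> 1"
  shows "flip_one \<in> signed_perms n"
proof -
  have "flip_one permutes {- int n..int n}"
    unfolding flip_one_def using assms by (intro permutes_swap_id) simp_all
  then show ?thesis
    by (simp add: signed_perms_def flip_one_eq)
qed

text \<open>
  Of two integers with distinct nonzero absolute values at most one is changed, and it is the
  one closer to \<open>0\<close>, on which the comparison does not depend.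
\<close>

lemma flip_one_less_iff:
  "\<bar>a\<bar> \<noteq> \<bar>b\<bar> \<Longrightarrow> a \<noteq> 0 \<Longrightarrow> b \<noteq> 0 \<Longrightarrow> flip_one a < flip_one b \<longleftrightarrow> a < b"
  by (auto simp: flip_one_eq)

lemma desD_set_flip_one:
  assumes "\<pi> \<in> signed_perms n"
  shows "desD_set n (flip_one \<circ> \<pi>) = desD_set n \<pi>"
proof -
  have abs: "\<bar>\<pi> i\<bar> \<noteq> \<bar>\<pi> j\<bar>" if "\<bar>i\<bar> \<noteq> \<bar>j\<bar>" for i j
    using signed_perms_abs_eq[OF assms] that by blast
  have nz: "\<pi> i \<noteq> 0" if "i \<noteq> 0" for i
    using abs[of i 0] that signed_perms_zero[OF assms] by simp
  have minus: "- flip_one a = flip_one (- a)" for a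
    by (simp add: flip_one_eq)
  have "entryD (flip_one \<circ> \<pi>) (i + 1) < entryD (flip_one \<circ> \<pi>) i \<longleftrightarrow> entryD \<pi> (i + 1) < entryD \<pi> i" for i
  proof (cases "i = 0")
    case True
    then show ?thesis
      using abs[of 1 2] nz[of 1] nz[of 2] by (simp add: entryD_def minus flip_one_less_iff)
  next
    case False
    then show ?thesis
      using abs[of "int i + 1" "int i"] nz[of "int i + 1"] nz[of "int i"]
      by (simp add: entryD_def flip_one_less_iff add.commute)
  qed
  then show ?thesis
    unfolding desD_set_def by blast
qed

text \<open>
  Exactly one position in the window carries the letter \<open>1\<close> or \<open>-1\<close>, and the sets of negative
  positions before and after the flip differ in this position only.
\<close>

lemma parity_flip_one:
  assumes "\<pi> \<in> signed_perms n" "n \<ge> 1"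
  shows "even (card {i \<in> {1..int n}. (flip_one \<circ> \<pi>) i < 0}) \<longleftrightarrow>
         odd (card {i \<in> {1..int n}. \<pi> i < 0})"
proof -
  let ?A = "{i \<in> {1..int n}. (flip_one \<circ> \<pi>) i < 0}" and ?B = "{i \<in> {1..int n}. \<pi> i < 0}"
  have fin: "finite ?A" "finite ?B" by (rule finite_Collect_conjI, simp)+
  define j where "j = inv \<pi> 1"
  have j: "\<pi> j = 1"
    using permutes_inverses(1)[OF signed_perms_permutes[OF assms(1)]] by (simp add: j_def)
  have "j \<in> {- int n..int n}"
    using permutes_in_image[OF signed_perms_permutes[OF assms(1)], of j] j assms(2) by auto
  moreover have "j \<noteq> 0"
    using j signed_perms_zero[OF assms(1)] by auto
  ultimately have range: "\<bar>j\<bar> \<in> {1..int n}" by auto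
  have one: "\<bar>\<pi> \<bar>j\<bar>\<bar> = 1"
    using j signed_perms_minus[OF assms(1), of j] by (auto simp: abs_if)
  have unique: "i = \<bar>j\<bar>" if "\<bar>\<pi> i\<bar> = 1" "i \<in> {1..int n}" for i
    using signed_perms_abs_eq[OF assms(1), of i "\<bar>j\<bar>"] one that by auto
  have same: "?A - {\<bar>j\<bar>} = ?B - {\<bar>j\<bar>}"
  proof -
    have "flip_one (\<pi> i) = \<pi> i" if "i \<in> {1..int n}" "i \<noteq> \<bar>j\<bar>" for i
      using unique[of i] that by (metis flip_one_eq)
    then show ?thesis
      by (auto simp del: abs_le_iff)
  qed
  have flipped: "\<bar>j\<bar> \<in> ?A \<longleftrightarrow> \<bar>j\<bar> \<notin> ?B"
    using range one by (auto simp: flip_one_eq)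
  consider "\<bar>j\<bar> \<notin> ?B" "?A = insert \<bar>j\<bar> ?B" | "\<bar>j\<bar> \<notin> ?A" "?B = insert \<bar>j\<bar> ?A"
  proof (cases "\<bar>j\<bar> \<in> ?B")
    case False
    then have "\<bar>j\<bar> \<in> ?A" using flipped by metis
    then have "?A = insert \<bar>j\<bar> (?A - {\<bar>j\<bar>})" by (rule insert_Diff[symmetric])
    also have "\<dots> = insert \<bar>j\<bar> ?B" unfolding same using False by simp
    finally show ?thesis using that(1) False by blast
  next
    case True
    then have "\<bar>j\<bar> \<notin> ?A" using flipped by metis
    have "?B = insert \<bar>j\<bar> (?B - {\<bar>j\<bar>})" using True by (rule insert_Diff[symmetric])
    also have "\<dots> = insert \<bar>j\<bar> ?A" unfolding same[symmetric] using \<open>\<bar>j\<bar> \<notin> ?A\<close> by simp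
    finally show ?thesis using that(2) \<open>\<bar>j\<bar> \<notin> ?A\<close> by blast
  qed
  then show ?thesis
  proof cases
    case 1
    then have "card ?A = Suc (card ?B)"
      using card_insert_disjoint[OF fin(2) 1(1)] 1(2) by simp
    then show ?thesis by simp
  next
    case 2
    then have "card ?B = Suc (card ?A)"
      using card_insert_disjoint[OF fin(1) 2(1)] 2(2) by simp
    then show ?thesis by simp
  qed
qed

text \<open>
  The flip is an involution that exchanges \<open>D\<^sub>n\<close> with its complement in \<open>B\<^sub>n\<close> and preserves
  descent sets.
\<close>

lemma sum_signed_perms_desD_set:
  fixes f :: "nat set \<Rightarrow> 'a::comm_ring_1"
  assumes "n \<ge> 1"
  shows "(\<Sum>\<pi>\<in>signed_perms n. f (desD_set n \<pi>)) = 2 * (\<Sum>\<pi>\<in>even_signed_perms n. f (desD_set n \<pi>))"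
proof -
  let ?E = "even_signed_perms n"
  have sub: "?E \<subseteq> signed_perms n"
    by (auto simp: even_signed_perms_def)
  have flip: "flip_one \<circ> \<pi> \<in> signed_perms n" if "\<pi> \<in> signed_perms n" for \<pi>
    using flip_one_signed_perms that assms by (intro signed_perms_comp) auto
  have invol: "flip_one \<circ> (flip_one \<circ> \<pi>) = \<pi>" for \<pi>
    by (auto simp: flip_one_eq)
  have "(\<Sum>\<pi>\<in>signed_perms n - ?E. f (desD_set n \<pi>)) = (\<Sum>\<pi>\<in>?E. f (desD_set n \<pi>))"
  proof (rule sum.reindex_bij_witness[of _ "(\<circ>) flip_one" "(\<circ>) flip_one"])
    fix \<pi> assume "\<pi> \<in> signed_perms n - ?E"
    then show "flip_one \<circ> \<pi> \<in> ?E" "f (desD_set n (flip_one \<circ> \<pi>)) = f (desD_set n \<pi>)"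
      using flip parity_flip_one[of \<pi> n] desD_set_flip_one[of \<pi> n] assms
      by (auto simp: even_signed_perms_def)
  next
    fix \<pi> assume "\<pi> \<in> ?E"
    then show "flip_one \<circ> \<pi> \<in> signed_perms n - ?E"
      using flip parity_flip_one[of \<pi> n] assms
      by (auto simp: even_signed_perms_def)
  qed (simp_all add: invol)
  then show ?thesis
    using sum.subset_diff[OF sub finite_signed_perms, of "\<lambda>\<pi>. f (desD_set n \<pi>)"] by simp
qed

section \<open>Inserting the largest letter\<close>

text \<open>
  Insertion of a letter is composition on the right with a coset representative of \<open>B\<^sub>n\<^sub>-\<^sub>1\<close> in
  \<open>B\<^sub>n\<close>: the signed permutation that sends \<open>k\<close> to \<open>s * n\<close> and closes the gap at \<open>k\<close> by moving
  the larger arguments one step towards \<open>0\<close>. If \<open>\<sigma>\<close> fixes \<open>n\<close>, the window of its composition with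
  this map is that of \<open>\<sigma>\<close> with \<open>s * n\<close> inserted as \<open>k\<close>-th letter.
\<close>

definition insertion :: "nat \<Rightarrow> nat \<Rightarrow> int \<Rightarrow> int \<Rightarrow> int" where
  "insertion n k s j =
     (if \<bar>j\<bar> = int k then s * sgn j * int n
      else if int k < \<bar>j\<bar> \<and> \<bar>j\<bar> \<le> int n then j - sgn j else j)"

definition removal :: "nat \<Rightarrow> nat \<Rightarrow> int \<Rightarrow> int \<Rightarrow> int" where
  "removal n k s j =
     (if \<bar>j\<bar> = int n then s * sgn j * int k
      else if int k \<le> \<bar>j\<bar> \<and> \<bar>j\<bar> < int n then j + sgn j else j)"

lemma removal_insertion:
  "k \<in> {1..n} \<Longrightarrow> s \<in> {1, -1} \<Longrightarrow> removal n k s (insertion n k s j) = j"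
  by (cases j "0::int" rule: linorder_cases)
     (auto simp: removal_def insertion_def sgn_if abs_if split: if_splits)

lemma insertion_removal:
  "k \<in> {1..n} \<Longrightarrow> s \<in> {1, -1} \<Longrightarrow> insertion n k s (removal n k s j) = j"
  by (cases j "0::int" rule: linorder_cases)
     (auto simp: removal_def insertion_def sgn_if abs_if split: if_splits)

lemma insertion_signed_perms:
  assumes "k \<in> {1..n}" "s \<in> {1, -1}"
  shows "insertion n k s \<in> signed_perms n" "removal n k s \<in> signed_perms n"
proof -
  have "bij (insertion n k s)" "bij (removal n k s)"
    using removal_insertion[OF assms] insertion_removal[OF assms]
    by (metis bijI')+
  moreover have "insertion n k s i = i" "removal n k s i = i" if "i \<notin> {- int n..int n}" for i
    using that assms by (auto simp: insertion_def removal_def)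
  ultimately have "insertion n k s permutes {- int n..int n}"
      "removal n k s permutes {- int n..int n}"
    by (auto simp: permutes_def bij_iff)
  then show "insertion n k s \<in> signed_perms n" "removal n k s \<in> signed_perms n"
    by (auto simp: signed_perms_def insertion_def removal_def)
qed

lemma insertion_window:
  assumes "\<sigma> \<in> signed_perms m" "n = Suc m" "k \<in> {1..n}" "s \<in> {1, -1}"
  shows "0 < i \<Longrightarrow> i < int k \<Longrightarrow> (\<sigma> \<circ> insertion n k s) i = \<sigma> i"
    and "(\<sigma> \<circ> insertion n k s) (int k) = s * int n"
    and "int k < i \<Longrightarrow> i \<le> int n \<Longrightarrow> (\<sigma> \<circ> insertion n k s) i = \<sigma> (i - 1)"
proof -
  have "\<sigma> (s * int n) = s * int n"
    using permutes_not_in[OF signed_perms_permutes[OF assms(1)], of "s * int n"] assms(2,4) by auto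
  then show "(\<sigma> \<circ> insertion n k s) (int k) = s * int n"
    using assms(3) by (simp add: insertion_def)
qed (use assms in \<open>auto simp: insertion_def\<close>)

text \<open>
  The place and the sign of the inserted letter are read off from the position of the letter of
  absolute value \<open>n\<close>; once they are known, \<open>\<sigma>\<close> is recovered by composing with the inverse coset
  representative, and what results fixes \<open>n\<close> and \<open>-n\<close>, hence lies in \<open>B\<^sub>n\<^sub>-\<^sub>1\<close>.
\<close>

lemma signed_perms_Suc_insertion:
  assumes "n = Suc m"
  shows "bij_betw (\<lambda>((k, s), \<sigma>). \<sigma> \<circ> insertion n k s) (({1..n} \<times> {1, -1}) \<times> signed_perms m)
           (signed_perms n)"
  unfolding bij_betw_def
proof
  show "inj_on (\<lambda>((k, s), \<sigma>). \<sigma> \<circ> insertion n k s) (({1..n} \<times> {1, -1}) \<times> signed_perms m)"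
  proof (rule inj_onI)
    fix x y
    assume x: "x \<in> ({1..n} \<times> {1, -1}) \<times> signed_perms m"
      and y: "y \<in> ({1..n} \<times> {1, -1}) \<times> signed_perms m"
      and xy: "(\<lambda>((k, s), \<sigma>). \<sigma> \<circ> insertion n k s) x = (\<lambda>((k, s), \<sigma>). \<sigma> \<circ> insertion n k s) y"
    obtain k s \<sigma> where x_eq: "x = ((k, s), \<sigma>)"
      by (metis surj_pair)
    obtain k' s' \<sigma>' where y_eq: "y = ((k', s'), \<sigma>')"
      by (metis surj_pair)
    have k: "k \<in> {1..n}" and s: "s \<in> {1, -1}" and \<sigma>: "\<sigma> \<in> signed_perms m"
      and k': "k' \<in> {1..n}" and s': "s' \<in> {1, -1}" and \<sigma>': "\<sigma>' \<in> signed_perms m"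
      and eq: "\<sigma> \<circ> insertion n k s = \<sigma>' \<circ> insertion n k' s'"
      using x y xy by (simp_all only: x_eq y_eq mem_Sigma_iff prod.case)
    have at: "(\<sigma> \<circ> insertion n k s) (int k) = s * int n"
        "(\<sigma> \<circ> insertion n k s) (int k') = s' * int n"
      using insertion_window(2)[OF \<sigma> assms k s] insertion_window(2)[OF \<sigma>' assms k' s'] eq
      by simp_all
    have "\<sigma> \<circ> insertion n k s \<in> signed_perms n"
      using signed_perms_comp[OF _ insertion_signed_perms(1)[OF k s]] signed_perms_Suc[OF \<sigma>] assms
      by simp
    moreover have "\<bar>(\<sigma> \<circ> insertion n k s) (int k)\<bar> = \<bar>(\<sigma> \<circ> insertion n k s) (int k')\<bar>"
      unfolding at using s s' by auto
    ultimately have "\<bar>int k\<bar> = \<bar>int k'\<bar>"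
      by (rule signed_perms_abs_eq)
    then have kk: "k = k'"
      by simp
    then have ss: "s = s'"
      using at assms by simp
    have "\<sigma> = \<sigma> \<circ> insertion n k s \<circ> removal n k s"
      using insertion_removal[OF k s] by auto
    also have "\<dots> = \<sigma>' \<circ> insertion n k s \<circ> removal n k s"
      using eq kk ss by simp
    also have "\<dots> = \<sigma>'"
      using insertion_removal[OF k s] by auto
    finally show "x = y"
      using kk ss by (simp add: x_eq y_eq)
  qed
next
  show "(\<lambda>((k, s), \<sigma>). \<sigma> \<circ> insertion n k s) ` (({1..n} \<times> {1, -1}) \<times> signed_perms m) = signed_perms n"
  proof (intro subset_antisym subsetI)
    fix \<pi> assume "\<pi> \<in> (\<lambda>((k, s), \<sigma>). \<sigma> \<circ> insertion n k s) ` (({1..n} \<times> {1, -1}) \<times> signed_perms m)"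
    then show "\<pi> \<in> signed_perms n"
      using signed_perms_comp[OF signed_perms_Suc insertion_signed_perms(1)] assms by auto
  next
    fix \<pi> assume \<pi>: "\<pi> \<in> signed_perms n"
    note perm = signed_perms_permutes[OF \<pi>]
    define j where "j = inv \<pi> (int n)"
    have j: "\<pi> j = int n"
      using permutes_inverses(1)[OF perm] by (simp add: j_def)
    define k where "k = nat \<bar>j\<bar>"
    define s where "s = sgn j"
    have "j \<in> {- int n..int n}"
      using permutes_in_image[OF perm, of j] j by auto
    moreover have j0: "j \<noteq> 0"
      using j signed_perms_zero[OF \<pi>] assms by auto
    ultimately have k: "k \<in> {1..n}" and s: "s \<in> {1, -1}"
      by (auto simp: k_def s_def sgn_if)
    have sk: "s * int k = j"
      by (simp add: k_def s_def sgn_mult_abs)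
    define \<sigma> where "\<sigma> = \<pi> \<circ> removal n k s"
    have \<sigma>n: "\<sigma> \<in> signed_perms n"
      unfolding \<sigma>_def using signed_perms_comp[OF \<pi> insertion_signed_perms(2)[OF k s]] .
    have top: "\<sigma> (int n) = int n"
      using assms j sk by (simp add: \<sigma>_def removal_def)
    have fixed: "\<forall>x\<in>{- int n..int n} - {- int m..int m}. \<sigma> x = x"
    proof
      fix x assume "x \<in> {- int n..int n} - {- int m..int m}"
      then have "x = int n \<or> x = - int n"
        using assms by auto
      then show "\<sigma> x = x"
        using top signed_perms_minus[OF \<sigma>n, of "int n"] by auto
    qed
    have "\<sigma> permutes {- int m..int m}"
      using permutes_superset[OF signed_perms_permutes[OF \<sigma>n]] fixed by blast
    then have "\<sigma> \<in> signed_perms m"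
      using signed_perms_minus[OF \<sigma>n] by (simp add: signed_perms_def)
    moreover have "\<pi> = \<sigma> \<circ> insertion n k s"
      using removal_insertion[OF k s] by (auto simp: \<sigma>_def)
    ultimately show "\<pi> \<in> (\<lambda>((k, s), \<sigma>). \<sigma> \<circ> insertion n k s) ` (({1..n} \<times> {1, -1}) \<times> signed_perms m)"
      using k s by (intro image_eqI[of _ _ "((k, s), \<sigma>)"]) auto
  qed
qed

section \<open>Descents after an insertion\<close>

definition descD :: "(int \<Rightarrow> int) \<Rightarrow> nat \<Rightarrow> nat" where
  "descD \<pi> i = of_bool (entryD \<pi> (i + 1) < entryD \<pi> i)"

lemma desD_eq_sum: "desD n \<pi> = (\<Sum>i<n. descD \<pi> i)"
proof -
  have "{..<n} \<inter> {i. entryD \<pi> (i + 1) < entryD \<pi> i} = desD_set n \<pi>"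
    by (auto simp: desD_set_def)
  then show ?thesis
    by (simp add: desD_def descD_def sum.inter_restrict flip: sum.inter_restrict)
qed

lemma descD_eq_desD_set: "i < n \<Longrightarrow> descD \<pi> i = of_bool (i \<in> desD_set n \<pi>)"
  by (simp add: descD_def desD_set_def)

lemma sum_lessThan_add:
  fixes f :: "nat \<Rightarrow> 'a::comm_monoid_add"
  shows "(\<Sum>i<a + b. f i) = (\<Sum>i<a. f i) + (\<Sum>i<b. f (a + i))"
  by (induction b) (simp_all add: add.assoc)

text \<open>
  Here \<open>\<pi>\<close> is any word of length \<open>n\<close> that arises from the word \<open>\<sigma>\<close> of length \<open>n - 1\<close> by
  inserting \<open>s * n\<close> as \<open>k\<close>-th letter. The numbers of descents are compared by equations
  between sums, with the lost descents added on the left, because subtraction of natural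
  numbers truncates.
\<close>

context
  fixes \<sigma> \<pi> :: "int \<Rightarrow> int" and m n k :: nat and s :: int
  assumes n: "n = Suc m" and m: "m \<ge> 2" and k: "k \<in> {1..n}" and s: "s \<in> {1, -1}"
    and before: "\<And>i. 0 < i \<Longrightarrow> i < int k \<Longrightarrow> \<pi> i = \<sigma> i"
    and at: "\<pi> (int k) = s * int n"
    and after: "\<And>i. int k < i \<Longrightarrow> i \<le> int n \<Longrightarrow> \<pi> i = \<sigma> (i - 1)"
    and bound: "\<And>i. 0 < i \<Longrightarrow> i \<le> int m \<Longrightarrow> \<bar>\<sigma> i\<bar> \<le> int m"
begin

text \<open>
  The place \<open>k = 2\<close> is exceptional: position \<open>0\<close> compares \<open>- \<pi>\<^sub>2\<close> with \<open>\<pi>\<^sub>1\<close>, so an insertion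
  as second letter affects a position that is not adjacent to it.
\<close>

lemma descD_before: "i + 1 < k \<Longrightarrow> k \<noteq> 2 \<Longrightarrow> descD \<pi> i = descD \<sigma> i"
  using before[of "int i"] before[of "int i + 1"] before[of 1] before[of 2]
  by (auto simp: descD_def entryD_def add.commute)

lemma descD_after: "i > k \<Longrightarrow> i > 1 \<Longrightarrow> i < n \<Longrightarrow> descD \<pi> i = descD \<sigma> (i - 1)"
  using after[of "int i"] after[of "int i + 1"]
  by (auto simp: descD_def entryD_def add.commute of_nat_diff)

text \<open>
  For \<open>3 \<le> k < n\<close> the new letter is a peak or a valley and so causes one descent at exactly one of
  its two sides. As first letter, \<open>n\<close> causes a descent at \<open>1\<close> and \<open>-n\<close> one at \<open>0\<close>.
\<close>

lemma desD_insertion: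
  assumes "k \<le> m" "k \<noteq> 2"
  shows "desD n \<pi> + descD \<sigma> (k - 1) = desD m \<sigma> + 1"
proof -
  obtain q where q: "k = Suc q"
    using k by (cases k) auto
  obtain r where r: "m = q + Suc r"
    using assms(1) q by (metis less_imp_Suc_add Suc_le_eq add_Suc_right)
  have nn: "n = q + Suc (Suc r)"
    using n r by simp
  have "(\<Sum>i<q. descD \<pi> i) = (\<Sum>i<q. descD \<sigma> i)"
    using descD_before assms(2) q by (intro sum.cong) auto
  moreover have "(\<Sum>i<r. descD \<pi> (q + Suc (Suc i))) = (\<Sum>i<r. descD \<sigma> (q + Suc i))"
    using descD_after q nn by (intro sum.cong) auto
  moreover have "descD \<pi> q + descD \<pi> (Suc q) = 1"
  proof (cases "q = 0")
    case True
    then show ?thesis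
      using at after[of 2] bound[of 1] s q n m by (auto simp: descD_def entryD_def)
  next
    case False
    then show ?thesis
      using at after[of "int q + 2"] before[of "int q"] bound[of "int q"] bound[of "int q + 1"]
        s q n r by (auto simp: descD_def entryD_def add.commute)
  qed
  ultimately show ?thesis
    unfolding desD_eq_sum nn r q sum_lessThan_add
    by (simp add: sum.lessThan_Suc_shift del: sum.lessThan_Suc)
qed

text \<open>
  The second letter \<open>n\<close> yields a descent at \<open>2\<close> only among the positions \<open>0, 1, 2\<close>; the second
  letter \<open>-n\<close> yields descents at \<open>0\<close> and \<open>1\<close> only.
\<close>

lemma desD_insertion_second:
  assumes "k = 2"
  shows "desD n \<pi> + descD \<sigma> 0 + descD \<sigma> 1 = desD m \<sigma> + (if s = 1 then 1 else 2)"
proof -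
  obtain r where r: "m = 2 + r"
    using m by (metis le_iff_add)
  have nn: "n = 3 + r"
    using n r by simp
  have "(\<Sum>i<r. descD \<pi> (3 + i)) = (\<Sum>i<r. descD \<sigma> (2 + i))"
    using descD_after assms nn by (intro sum.cong) auto
  moreover have "descD \<pi> 0 + descD \<pi> 1 + descD \<pi> 2 = (if s = 1 then 1 else 2)"
    using at after[of 3] before[of 1] bound[of 1] bound[of 2] s n m assms
    by (auto simp: descD_def entryD_def)
  ultimately show ?thesis
    unfolding desD_eq_sum nn r sum_lessThan_add by (simp add: numeral_eq_Suc)
qed

lemma desD_insertion_last:
  assumes "k = n"
  shows "desD n \<pi> = desD m \<sigma> + (if s = 1 then 0 else 1)"
proof -
  have "(\<Sum>i<m. descD \<pi> i) = (\<Sum>i<m. descD \<sigma> i)"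
    using descD_before assms n m by (intro sum.cong) auto
  moreover have "descD \<pi> m = (if s = 1 then 0 else 1)"
    using at before[of "int m"] bound[of "int m"] s n m assms
    by (auto simp: descD_def entryD_def add.commute)
  ultimately show ?thesis
    unfolding desD_eq_sum n by simp
qed

end

section \<open>The recurrence\<close>

text \<open>
  The contribution, multiplied by \<open>t\<close>, of one signed permutation with descent set \<open>S\<close> to the
  right-hand side of the recurrence. The factor \<open>t\<close> removes the negative power, so that the
  identity makes sense in any commutative ring.
\<close>

definition local_weight :: "nat \<Rightarrow> 'a::comm_ring_1 \<Rightarrow> nat set \<Rightarrow> 'a" where
  "local_weight n t S =
     2 * of_nat n * t^2 * t ^ card S + 2 * t * (1 - t) * (of_nat (card S) * t ^ card S)
     + (1 - t^2) * (if 0 \<in> S \<and> 1 \<in> S then t ^ card S else 0)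
     + t * (1 - t)^2 * (if 0 \<notin> S \<and> 1 \<notin> S then t ^ card S else 0)
     + 2 * t * (1 - t) * (if 0 \<in> S \<and> 1 \<notin> S then t ^ card S else 0)"

text \<open>
  The insertions at the places other than \<open>2\<close> and \<open>n\<close> contribute
  \<open>2t\<^sup>d \<cdot> \<Sum>\<^sub>i (t + e\<^sub>i(1 - t))\<close>, where \<open>i\<close> runs through all positions except \<open>1\<close>; since
  \<open>\<Sum>\<^sub>i e\<^sub>i = d - e\<^sub>1\<close>, this depends on \<open>d\<close> and \<open>e\<^sub>1\<close> only. With the insertions at \<open>2\<close> and \<open>n\<close>
  everything is a function of \<open>d\<close>, \<open>e\<^sub>0\<close> and \<open>e\<^sub>1\<close>, and the four cases are checked separately.
\<close>

lemma sum_over_insertions: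
  fixes t :: "'a::comm_ring_1"
  assumes \<sigma>: "\<sigma> \<in> signed_perms m" and n: "n = Suc m" and m: "m \<ge> 2"
  shows "t * (\<Sum>(k, s)\<in>{1..n} \<times> {1, -1}. t ^ desD n (\<sigma> \<circ> insertion n k s)) =
         local_weight n t (desD_set m \<sigma>)"
proof -
  define d where "d = desD m \<sigma>"
  define e where "e = descD \<sigma>"
  define w where "w k s = t ^ desD n (\<sigma> \<circ> insertion n k s)" for k s
  have bound: "\<bar>\<sigma> i\<bar> \<le> int m" if "0 < i" "i \<le> int m" for i
    using signed_perms_abs_le[OF \<sigma>, of i] that by simp
  note window = insertion_window[OF \<sigma> n]
  have generic: "w k s = t ^ d * (t + of_nat (e (k - 1)) * (1 - t))"
    if "k \<in> {1..m} - {2}" "s \<in> {1, -1}" for k s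
  proof -
    have "desD n (\<sigma> \<circ> insertion n k s) + e (k - 1) = d + 1"
      unfolding d_def e_def using that n
      by (intro desD_insertion[OF n m _ _ window bound]) auto
    moreover have "e (k - 1) = 0 \<or> e (k - 1) = 1"
      by (simp add: e_def descD_def)
    ultimately show ?thesis
      by (auto simp: w_def)
  qed
  have second: "desD n (\<sigma> \<circ> insertion n 2 s) + e 0 + e 1 = d + (if s = 1 then 1 else 2)"
    if "s \<in> {1, -1}" for s
    unfolding d_def e_def using that n m
    by (intro desD_insertion_second[OF n m _ _ window bound]) auto
  have last: "w n s = t ^ d * (if s = 1 then 1 else t)" if "s \<in> {1, -1}" for s
  proof -
    have "desD n (\<sigma> \<circ> insertion n n s) = d + (if s = 1 then 0 else 1)"
      unfolding d_def using that n
      by (intro desD_insertion_last[OF n m _ _ window bound]) auto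
    then show ?thesis by (simp add: w_def)
  qed
  \<comment> \<open>The places \<open>n\<close> and \<open>2\<close> are split off: they are the two at which the signs differ.\<close>
  have split: "{1..n} = insert n (insert 2 ({1..m} - {2}))"
    using n m by auto
  have "(\<Sum>k\<in>{1..m} - {2}. w k 1 + w k (-1)) =
        (\<Sum>k\<in>{1..m} - {2}. 2 * t ^ d * (t + of_nat (e (k - 1)) * (1 - t)))"
    using generic by (intro sum.cong) auto
  also have "\<dots> = (\<Sum>i\<in>{..<m} - {1}. 2 * t ^ d * (t + of_nat (e i) * (1 - t)))"
    by (rule sum.reindex_bij_witness[of _ Suc "\<lambda>k. k - 1"]) auto
  also have "\<dots> = 2 * t ^ d * (of_nat (m - 1) * t + of_nat (\<Sum>i\<in>{..<m} - {1}. e i) * (1 - t))"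
    using m by (simp add: sum.distrib flip: sum_distrib_left sum_distrib_right)
  finally have middle: "(\<Sum>k\<in>{1..m} - {2}. w k 1 + w k (-1)) =
      2 * t ^ d * (of_nat (m - 1) * t + of_nat (\<Sum>i\<in>{..<m} - {1}. e i) * (1 - t))" .
  have "d = e 1 + (\<Sum>i\<in>{..<m} - {1}. e i)"
    unfolding d_def e_def desD_eq_sum using m by (subst sum.remove[of _ 1]) auto
  then have sum_e: "(of_nat (\<Sum>i\<in>{..<m} - {1}. e i) :: 'a) = of_nat d - of_nat (e 1)"
    by simp
  have m1: "(of_nat (m - 1) :: 'a) = of_nat n - 2"
    using m n by (simp add: of_nat_diff)
  have "(\<Sum>(k, s)\<in>{1..n} \<times> {1, -1}. w k s) = (\<Sum>k\<in>{1..n}. w k 1 + w k (-1))"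
    by (simp flip: sum.cartesian_product)
  also have "\<dots> = (w n 1 + w n (-1)) + (w 2 1 + w 2 (-1)) + (\<Sum>k\<in>{1..m} - {2}. w k 1 + w k (-1))"
    unfolding split using n m by (simp del: insert_Diff_single)
  also have "\<dots> = t ^ d * (1 + t) + (w 2 1 + w 2 (-1))
      + 2 * t ^ d * ((of_nat n - 2) * t + (of_nat d - of_nat (e 1)) * (1 - t))"
    unfolding middle sum_e m1 using last[of 1] last[of "-1"] by (simp add: algebra_simps)
  finally have total: "t * (\<Sum>(k, s)\<in>{1..n} \<times> {1, -1}. w k s) =
      t * (t ^ d * (1 + t)) + (t * w 2 1 + t * w 2 (-1))
      + t * (2 * t ^ d * ((of_nat n - 2) * t + (of_nat d - of_nat (e 1)) * (1 - t)))"
    by (simp only: distrib_left)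
  have S: "card (desD_set m \<sigma>) = d" "0 \<in> desD_set m \<sigma> \<longleftrightarrow> e 0 = 1" "1 \<in> desD_set m \<sigma> \<longleftrightarrow> e 1 = 1"
    using m by (simp_all add: d_def e_def desD_def descD_eq_desD_set[of _ m])
  have "e 0 = 0 \<or> e 0 = 1" "e 1 = 0 \<or> e 1 = 1"
    by (simp_all add: e_def descD_def)
  then consider "e 0 = 1" "e 1 = 1" | "e 0 = 1" "e 1 = 0" | "e 0 = 0" "e 1 = 1" | "e 0 = 0" "e 1 = 0"
    by metis
  then have "t * (\<Sum>(k, s)\<in>{1..n} \<times> {1, -1}. w k s) = local_weight n t (desD_set m \<sigma>)"
  proof cases
    case 1
    \<comment> \<open>Inserting \<open>n\<close> destroys two descents and creates one: this is the source of \<open>t\<^sup>-\<^sup>1\<close>.\<close>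
    then have "desD n (\<sigma> \<circ> insertion n 2 1) + 1 = d" "desD n (\<sigma> \<circ> insertion n 2 (-1)) = d"
      using second[of 1] second[of "-1"] by auto
    then have "t * w 2 1 = t ^ d" "w 2 (-1) = t ^ d"
      unfolding w_def by (simp_all flip: power_Suc)
    then show ?thesis
      unfolding total local_weight_def S using 1 by (simp add: algebra_simps power2_eq_square)
  next
    case 2
    then have "w 2 1 = t ^ d" "w 2 (-1) = t * t ^ d"
      using second[of 1] second[of "-1"] by (auto simp: w_def)
    then show ?thesis
      unfolding total local_weight_def S using 2 by (simp add: algebra_simps power2_eq_square)
  next
    case 3
    then have "w 2 1 = t ^ d" "w 2 (-1) = t * t ^ d"
      using second[of 1] second[of "-1"] by (auto simp: w_def)
    then show ?thesis
      unfolding total local_weight_def S using 3 by (simp add: algebra_simps power2_eq_square)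
  next
    case 4
    then have "w 2 1 = t * t ^ d" "w 2 (-1) = t * (t * t ^ d)"
      using second[of 1] second[of "-1"] by (auto simp: w_def)
    then show ?thesis
      unfolding total local_weight_def S using 4 by (simp add: algebra_simps power2_eq_square)
  qed
  then show ?thesis
    by (simp add: w_def)
qed

lemma sum_even_signed_perms_recurrence:
  assumes n: "n = Suc m" and m: "m \<ge> 2"
  shows "[:0, 1:] * eulerianD n = (\<Sum>\<sigma>\<in>even_signed_perms m. local_weight n [:0, 1:] (desD_set m \<sigma>))"
proof -
  let ?t = "[:0, 1:] :: int poly"
  have "2 * (?t * eulerianD n) = ?t * (\<Sum>\<pi>\<in>signed_perms n. ?t ^ desD n \<pi>)"
    unfolding eulerianD_def desD_def using sum_signed_perms_desD_set[of n "\<lambda>S. ?t ^ card S"] n m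
    by simp
  also have "(\<Sum>\<pi>\<in>signed_perms n. ?t ^ desD n \<pi>) =
      (\<Sum>x\<in>({1..n} \<times> {1, -1}) \<times> signed_perms m. ?t ^ desD n ((\<lambda>((k, s), \<sigma>). \<sigma> \<circ> insertion n k s) x))"
    by (rule sum.reindex_bij_betw[symmetric, OF signed_perms_Suc_insertion[OF n]])
  also have "\<dots> = (\<Sum>ks\<in>{1..n} \<times> {1, -1}. \<Sum>\<sigma>\<in>signed_perms m. ?t ^ desD n (\<sigma> \<circ> insertion n (fst ks) (snd ks)))"
    by (simp add: sum.cartesian_product case_prod_beta)
  also have "\<dots> = (\<Sum>\<sigma>\<in>signed_perms m. \<Sum>(k, s)\<in>{1..n} \<times> {1, -1}. ?t ^ desD n (\<sigma> \<circ> insertion n k s))"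
    by (subst sum.swap) (simp add: case_prod_beta)
  also have "?t * \<dots> = (\<Sum>\<sigma>\<in>signed_perms m. local_weight n ?t (desD_set m \<sigma>))"
    by (subst sum_distrib_left) (intro sum.cong refl sum_over_insertions n m)
  also have "\<dots> = 2 * (\<Sum>\<sigma>\<in>even_signed_perms m. local_weight n ?t (desD_set m \<sigma>))"
    using m by (intro sum_signed_perms_desD_set) simp
  finally show ?thesis
    unfolding mult_cancel_left by simp
qed

lemma pCons_0_1_times_pderiv_power:
  "[:0, 1:] * pderiv ([:0, 1:] ^ d) = of_nat d * ([:0, 1:] ^ d :: int poly)"
proof (induction d)
  case (Suc d)
  let ?t = "[:0, 1:] :: int poly"
  have "pderiv ?t = 1"
    by (simp add: pderiv_pCons)
  then have "?t * pderiv (?t ^ Suc d) = ?t * (?t * pderiv (?t ^ d)) + ?t ^ Suc d"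
    by (simp only: power_Suc pderiv_mult mult_1_right distrib_left)
  also have "\<dots> = of_nat (Suc d) * ?t ^ Suc d"
    by (simp only: Suc.IH of_nat_Suc power_Suc distrib_right mult_1_left mult.left_commute add.commute)
  finally show ?case .
qed simp

lemma pderiv_sum: "pderiv (\<Sum>x\<in>A. f x) = (\<Sum>x\<in>A. pderiv (f x))"
  by (induction A rule: infinite_finite_induct) (simp_all add: pderiv_add)

lemma eulerianD_recurrence:
  assumes n: "n = Suc m" and m: "m \<ge> 2"
  defines "t \<equiv> [:0, 1:] :: int poly"
  shows "t * eulerianD n =
         2 * of_nat n * t^2 * eulerianD m + 2 * t * (1 - t) * (t * pderiv (eulerianD m))
         + (1 - t^2) * eulerianD_01 m + t * (1 - t)^2 * eulerianD_ge2 m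
         + 2 * t * (1 - t) * eulerianD_0_ge2 m"
proof -
  have deriv: "t * pderiv (eulerianD m) = (\<Sum>\<sigma>\<in>even_signed_perms m. of_nat (desD m \<sigma>) * t ^ desD m \<sigma>)"
    unfolding eulerianD_def t_def by (simp only: pderiv_sum sum_distrib_left pCons_0_1_times_pderiv_power)
  show ?thesis
    unfolding sum_even_signed_perms_recurrence[OF n m, folded t_def] deriv
    unfolding local_weight_def eulerianD_def eulerianD_01_def eulerianD_ge2_def eulerianD_0_ge2_def t_def[symmetric]
      sum.inter_filter[OF finite_even_signed_perms] desD_def
    by (simp only: sum.distrib sum_distrib_left)
qed

theorem corollary3p4:
  fixes n :: nat
  assumes "n \<ge> 3"
  shows "to_fract (eulerianD n) =
           2 * of_nat n * tvar * to_fract (eulerianD (n - 1))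
         + 2 * tvar * (1 - tvar) * to_fract (pderiv (eulerianD (n - 1)))
         + (inverse tvar - tvar) * to_fract (eulerianD_01 (n - 1))
         + (1 - tvar) ^ 2 * to_fract (eulerianD_ge2 (n - 1))
         + 2 * (1 - tvar) * to_fract (eulerianD_0_ge2 (n - 1))"
proof -
  have hom_nat: "to_fract (of_nat k :: int poly) = of_nat k" for k :: nat
    by (induction k) (simp_all)
  have hom_2: "to_fract 2 = (2 :: int poly fract)"
    using hom_nat[of 2] by simp
  have nz: "tvar \<noteq> 0"
    by (simp add: tvar_def)
  obtain m where n: "n = Suc m" and m: "m \<ge> 2"
    using assms by (cases n) auto
  from arg_cong[OF eulerianD_recurrence[OF n m], of to_fract]
  have rec: "tvar * to_fract (eulerianD n) =
      2 * of_nat n * tvar^2 * to_fract (eulerianD m)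
    + 2 * tvar * (1 - tvar) * (tvar * to_fract (pderiv (eulerianD m)))
    + (1 - tvar^2) * to_fract (eulerianD_01 m)
    + tvar * (1 - tvar)^2 * to_fract (eulerianD_ge2 m)
    + 2 * tvar * (1 - tvar) * to_fract (eulerianD_0_ge2 m)"
    by (simp only: to_fract_add to_fract_mult to_fract_diff to_fract_1 hom_nat hom_2 power2_eq_square
          tvar_def[symmetric])
  have "tvar * (2 * of_nat n * tvar * to_fract (eulerianD m)
         + 2 * tvar * (1 - tvar) * to_fract (pderiv (eulerianD m))
         + (inverse tvar - tvar) * to_fract (eulerianD_01 m)
         + (1 - tvar) ^ 2 * to_fract (eulerianD_ge2 m)
         + 2 * (1 - tvar) * to_fract (eulerianD_0_ge2 m)) = tvar * to_fract (eulerianD n)"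
    unfolding rec using nz by (simp add: field_simps power2_eq_square)
  then show ?thesis
    using nz n by simp
qed

end
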